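(* Let $M$ be an o-minimal structure. For any formula $\varphi(x;y)$ in the language of $M$ and any infinite set $A\subseteq M^{|x|}$ that is definable in $M$ (possibly with parameters), it holds that \[ |\{\varphi(A;b) : b\in M^{|y|}\}| \leq |A|. \]
   Context: O-minimality is understood in the sense of van den Dries' book "Tame Topology and O-minimal Structures": $M$ is an expansion of a dense linear order $(M,<)$ without endpoints such that every subset of $M$ definable with parameters is a finite union of points and open intervals with endpoints in $M\cup\{-\infty,+\infty\}$. "Definable" means definable in $M$, possibly with parameters from $M$. Here $x$ and $y$ are finite tuples of variables, of lengths $|x|$ and $|y|$. For a partitioned formula $\varphi(x;y)$, a set $A\subseteq M^{|x|}$ and $b\in M^{|y|}$, we write $\varphi(A;b)=\{a\in A : M\models \varphi(a;b)\}$. Bars around sets denote cardinality. *)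

theory Defs
  imports Main "HOL-Library.Extended"
begin

unbundle cardinal_syntax

(* A signature consists of (symbol, arity) pairs; constants are function symbols of arity 0. *)
record ('f, 'r) language =
  funs :: "('f \<times> nat) set"
  rels :: "('r \<times> nat) set"

datatype 'f fo_term = Var nat | Fun 'f "'f fo_term list"

datatype ('f, 'r) formula =
    Eq "'f fo_term" "'f fo_term"
  | Rel 'r "'f fo_term list"
  | Neg "('f, 'r) formula"
  | Conj "('f, 'r) formula" "('f, 'r) formula"
  | Exists nat "('f, 'r) formula"

fun term_vars :: "'f fo_term \<Rightarrow> nat set" where
  "term_vars (Var v) = {v}"
| "term_vars (Fun f ts) = (\<Union>t\<in>set ts. term_vars t)"

fun free_vars :: "('f, 'r) formula \<Rightarrow> nat set" where
  "free_vars (Eq s t) = term_vars s \<union> term_vars t"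
| "free_vars (Rel r ts) = (\<Union>t\<in>set ts. term_vars t)"
| "free_vars (Neg \<phi>) = free_vars \<phi>"
| "free_vars (Conj \<phi> \<psi>) = free_vars \<phi> \<union> free_vars \<psi>"
| "free_vars (Exists v \<phi>) = free_vars \<phi> - {v}"

fun term_in :: "('f, 'r) language \<Rightarrow> 'f fo_term \<Rightarrow> bool" where
  "term_in L (Var v) = True"
| "term_in L (Fun f ts) = ((f, length ts) \<in> funs L \<and> (\<forall>t\<in>set ts. term_in L t))"

fun formula_in :: "('f, 'r) language \<Rightarrow> ('f, 'r) formula \<Rightarrow> bool" where
  "formula_in L (Eq s t) = (term_in L s \<and> term_in L t)"
| "formula_in L (Rel r ts) = ((r, length ts) \<in> rels L \<and> (\<forall>t\<in>set ts. term_in L t))"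
| "formula_in L (Neg \<phi>) = formula_in L \<phi>"
| "formula_in L (Conj \<phi> \<psi>) = (formula_in L \<phi> \<and> formula_in L \<psi>)"
| "formula_in L (Exists v \<phi>) = formula_in L \<phi>"

(* The universe is the type 'm. Interpretations are total on symbols and argument lists;
   only their values on (symbol, length) pairs in the signature are ever used, as every
   formula below is required to satisfy formula_in. *)
record ('f, 'r, 'm) fo_structure =
  fun_interp :: "'f \<Rightarrow> 'm list \<Rightarrow> 'm"
  rel_interp :: "'r \<Rightarrow> 'm list \<Rightarrow> bool"

fun term_val :: "('f, 'r, 'm) fo_structure \<Rightarrow> (nat \<Rightarrow> 'm) \<Rightarrow> 'f fo_term \<Rightarrow> 'm" where
  "term_val M e (Var v) = e v"
| "term_val M e (Fun f ts) = fun_interp M f (map (term_val M e) ts)"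

fun sat :: "('f, 'r, 'm) fo_structure \<Rightarrow> (nat \<Rightarrow> 'm) \<Rightarrow> ('f, 'r) formula \<Rightarrow> bool" where
  "sat M e (Eq s t) = (term_val M e s = term_val M e t)"
| "sat M e (Rel r ts) = rel_interp M r (map (term_val M e) ts)"
| "sat M e (Neg \<phi>) = (\<not> sat M e \<phi>)"
| "sat M e (Conj \<phi> \<psi>) = (sat M e \<phi> \<and> sat M e \<psi>)"
| "sat M e (Exists v \<phi>) = (\<exists>m. sat M (e(v := m)) \<phi>)"

lemma term_val_cong:
  "\<forall>v\<in>term_vars t. e v = e' v \<Longrightarrow> term_val M e t = term_val M e' t"
proof (induction t)
  case (Var v)
  then show ?case by simp
next
  case (Fun f ts)
  have "term_val M e t = term_val M e' t" if "t \<in> set ts" for t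
    by (rule Fun.IH[OF that]) (use Fun.prems that in \<open>simp\<close>)
  then have "map (term_val M e) ts = map (term_val M e') ts"
    by (simp only: map_eq_conv) blast
  then show ?case
    by (simp only: term_val.simps)
qed

lemma sat_cong:
  "\<forall>v\<in>free_vars \<phi>. e v = e' v \<Longrightarrow> sat M e \<phi> = sat M e' \<phi>"
proof (induction \<phi> arbitrary: e e')
  case (Eq s t)
  then have "term_val M e s = term_val M e' s" "term_val M e t = term_val M e' t"
    by (simp_all add: term_val_cong)
  then show ?case
    by (simp only: sat.simps)
next
  case (Rel r ts)
  have "term_val M e t = term_val M e' t" if "t \<in> set ts" for t
    by (rule term_val_cong) (use Rel.prems that in \<open>simp\<close>)
  then have "map (term_val M e) ts = map (term_val M e') ts"
    by (simp only: map_eq_conv) blast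
  then show ?case
    by (simp only: sat.simps)
next
  case (Neg \<phi>)
  have "sat M e \<phi> = sat M e' \<phi>"
    by (rule Neg.IH) (use Neg.prems in \<open>simp\<close>)
  then show ?case by (simp only: sat.simps)
next
  case (Conj \<phi> \<psi>)
  have "sat M e \<phi> = sat M e' \<phi>"
    by (rule Conj.IH(1)) (use Conj.prems in \<open>simp\<close>)
  moreover have "sat M e \<psi> = sat M e' \<psi>"
    by (rule Conj.IH(2)) (use Conj.prems in \<open>simp\<close>)
  ultimately show ?case by (simp only: sat.simps)
next
  case (Exists v \<phi>)
  have "sat M (e(v := m)) \<phi> = sat M (e'(v := m)) \<phi>" for m
    by (rule Exists.IH) (use Exists.prems in \<open>simp\<close>)
  then show ?case by (simp only: sat.simps)
qed

definition tuples :: "nat \<Rightarrow> 'm list set" where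
  "tuples n = {a. length a = n}"

(* A partitioned formula phi(x; y): x and y are disjoint tuples of distinct variables
   among which all free variables of phi occur. *)
definition partitioned_formula ::
  "('f, 'r) language \<Rightarrow> ('f, 'r) formula \<Rightarrow> nat list \<Rightarrow> nat list \<Rightarrow> bool" where
  "partitioned_formula L \<phi> x y \<longleftrightarrow>
     formula_in L \<phi> \<and> distinct (x @ y) \<and> free_vars \<phi> \<subseteq> set (x @ y)"

(* M |= phi(a; b), for length a = length x and length b = length y. Variables outside x and y
   receive an unspecified value, which is irrelevant by sat_cong. *)
definition holds_at ::
  "('f, 'r, 'm) fo_structure \<Rightarrow> ('f, 'r) formula \<Rightarrow> nat list \<Rightarrow> nat list \<Rightarrow> 'm list \<Rightarrow> 'm list \<Rightarrow> bool"
  where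
  "holds_at M \<phi> x y a b \<longleftrightarrow> sat M (\<lambda>v. the (map_of (zip (x @ y) (a @ b)) v)) \<phi>"

definition formula_trace ::
  "('f, 'r, 'm) fo_structure \<Rightarrow> ('f, 'r) formula \<Rightarrow> nat list \<Rightarrow> nat list \<Rightarrow> 'm list set \<Rightarrow> 'm list
    \<Rightarrow> 'm list set" where
  "formula_trace M \<phi> x y A b = {a \<in> A. holds_at M \<phi> x y a b}"

definition definable ::
  "('f, 'r) language \<Rightarrow> ('f, 'r, 'm) fo_structure \<Rightarrow> nat \<Rightarrow> 'm list set \<Rightarrow> bool" where
  "definable L M n A \<longleftrightarrow>
     (\<exists>\<psi> x z c. partitioned_formula L \<psi> x z \<and> length x = n \<and> length c = length z \<and>
        A = {a \<in> tuples n. holds_at M \<psi> x z a c})"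

definition expands_order ::
  "('f, 'r) language \<Rightarrow> ('f, 'r, 'm::unbounded_dense_linorder) fo_structure \<Rightarrow> bool" where
  "expands_order L M \<longleftrightarrow>
     (\<exists>lt. (lt, 2) \<in> rels L \<and> (\<forall>a b. rel_interp M lt [a, b] \<longleftrightarrow> a < b))"

definition open_interval :: "'m::linorder set \<Rightarrow> bool" where
  "open_interval I \<longleftrightarrow>
     (\<exists>l u :: 'm extended. l < u \<and> I = {a. l < Fin a \<and> Fin a < u})"

definition finite_union_points_intervals :: "'m::linorder set \<Rightarrow> bool" where
  "finite_union_points_intervals S \<longleftrightarrow>
     (\<exists>C. finite C \<and> (\<forall>I\<in>C. (\<exists>a. I = {a}) \<or> open_interval I) \<and> S = \<Union>C)"

definition o_minimal ::
  "('f, 'r) language \<Rightarrow> ('f, 'r, 'm::unbounded_dense_linorder) fo_structure \<Rightarrow> bool" where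
  "o_minimal L M \<longleftrightarrow>
     expands_order L M \<and>
     (\<forall>S. definable L M 1 S \<longrightarrow> finite_union_points_intervals {a. [a] \<in> S})"

end

theory Submission
  imports Defs "HOL-Library.Countable"
begin

text \<open>
  Induction on the length of \<open>y\<close>, for all infinite definable \<open>A\<close> at once. Split a parameter tuple as \<open>(t, b)\<close>
  and let \<open>F a\<close> be the set of all \<open>t\<close> with \<open>\<phi>(a; t, b)\<close>. By o-minimality \<open>F a\<close> has a finite frontier, and the union
  \<open>E\<close> of these frontiers over \<open>a \<in> A\<close> is definable, so it has a finite frontier too. If \<open>t\<close> lies in the frontier
  of \<open>F a\<close>, then \<open>t\<close> is determined by \<open>a\<close>, \<open>b\<close> and its rank in that frontier. If \<open>t\<close> lies outside \<open>E\<close>, then the trace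
  of \<open>(t, b)\<close> on \<open>A\<close> is determined by \<open>b\<close> and the position of \<open>t\<close> relative to the frontier of \<open>E\<close>, because no
  \<open>F a\<close> changes along an interval that avoids \<open>E\<close>. In both cases the trace of \<open>(t, b)\<close> is a section at
  some \<open>a \<in> A\<close> of the trace of \<open>b\<close> on \<open>A \<times> A\<close> for one of countably many formulas with shorter parameter tuple.
\<close>

section \<open>Frontiers in linear orders\<close>

text \<open>In an order without endpoints this is the boundary of \<open>S\<close> in the order
  topology. Written with bounds \<open>l\<close> and \<open>u\<close> it is a first-order condition
  on \<open>S\<close> and \<open><\<close>, so it stays definable when \<open>S\<close> varies in a
  definable family.\<close>

definition frontier_pts :: "'a::linorder set \<Rightarrow> 'a set" where
  "frontier_pts S = {t. \<forall>l u. l < t \<and> t < u \<longrightarrow> (\<exists>s. l < s \<and> s < u \<and> (s \<in> S) \<noteq> (t \<in> S))}"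

definition separates :: "'a::linorder set \<Rightarrow> 'a set \<Rightarrow> bool" where
  "separates G S \<longleftrightarrow> (\<forall>t t'. t \<le> t' \<and> {t..t'} \<inter> G = {} \<longrightarrow> (t \<in> S \<longleftrightarrow> t' \<in> S))"

lemma separatesD:
  "separates G S \<Longrightarrow> t \<le> t' \<Longrightarrow> {t..t'} \<inter> G = {} \<Longrightarrow> t \<in> S \<longleftrightarrow> t' \<in> S"
  unfolding separates_def by blast

lemma separates_mono: "separates G S \<Longrightarrow> G \<subseteq> H \<Longrightarrow> separates H S"
  unfolding separates_def by blast

lemma separates_Union: "(\<And>S. S \<in> C \<Longrightarrow> separates G S) \<Longrightarrow> separates G (\<Union>C)"
  unfolding separates_def by blast

lemma separates_point: "separates {a} {a}"
  unfolding separates_def by auto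

lemma separates_open_interval:
  fixes l u :: "'a::linorder extended"
  shows "separates {a. Fin a = l \<or> Fin a = u} {a. l < Fin a \<and> Fin a < u}"
  unfolding separates_def
proof (intro allI impI, elim conjE)
  fix t t' :: 'a
  assume le: "t \<le> t'" and avoid: "{t..t'} \<inter> {a. Fin a = l \<or> Fin a = u} = {}"
  have "l < Fin t \<longleftrightarrow> l < Fin t'"
  proof (cases l)
    case (Fin c)
    then have "c < t \<or> t' < c" using avoid by (auto simp: not_less[symmetric])
    then show ?thesis using Fin le by auto
  qed simp_all
  moreover have "Fin t < u \<longleftrightarrow> Fin t' < u"
  proof (cases u)
    case (Fin c)
    then have "c < t \<or> t' < c" using avoid by (auto simp: not_less[symmetric])
    then show ?thesis using Fin le by auto
  qed simp_all
  ultimately show "t \<in> {a. l < Fin a \<and> Fin a < u} \<longleftrightarrow> t' \<in> {a. l < Fin a \<and> Fin a < u}"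
    by simp
qed

lemma finite_separator:
  assumes "finite_union_points_intervals S"
  shows "\<exists>G. finite G \<and> separates G S"
proof -
  obtain C where C: "finite C" "\<forall>I\<in>C. (\<exists>a. I = {a}) \<or> open_interval I" "S = \<Union>C"
    using assms unfolding finite_union_points_intervals_def by blast
  have "\<exists>G. finite G \<and> separates G I" if "I \<in> C" for I
  proof (cases "\<exists>a. I = {a}")
    case True
    then show ?thesis using separates_point by blast
  next
    case False
    then have "open_interval I" using C(2) that by blast
    then obtain l u where I: "I = {a. l < Fin a \<and> Fin a < u}"
      unfolding open_interval_def by (elim exE conjE) (rule that)
    have "{a. Fin a = l \<or> Fin a = u} = Fin -` {l, u}"
      by auto
    then have "finite {a. Fin a = l \<or> Fin a = u}"
      by (simp add: finite_vimageI inj_on_def)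
    then show ?thesis
      using separates_open_interval I by blast
  qed
  then have "\<exists>G. \<forall>I\<in>C. finite (G I) \<and> separates (G I) I"
    by (intro bchoice ballI)
  then obtain G where G: "\<And>I. I \<in> C \<Longrightarrow> finite (G I)" "\<And>I. I \<in> C \<Longrightarrow> separates (G I) I"
    by blast
  have "separates (\<Union>(G ` C)) S"
    unfolding C(3) by (rule separates_Union, rule separates_mono[OF G(2)]) auto
  then show ?thesis
    using C(1) G(1) by (intro exI[of _ "\<Union>(G ` C)"]) simp
qed

text \<open>A finite \<open>G\<close> missing \<open>t\<close> leaves an open interval around
  \<open>t\<close> free of \<open>G\<close>; \<open>S\<close> is constant there, so \<open>t\<close>
  is no frontier point.\<close>

lemma frontier_pts_subset:
  fixes S :: "'a::unbounded_dense_linorder set"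
  assumes "finite G" "separates G S"
  shows "frontier_pts S \<subseteq> G"
proof
  fix t assume t: "t \<in> frontier_pts S"
  show "t \<in> G"
  proof (rule ccontr)
    assume "t \<notin> G"
    \<comment> \<open>Without endpoints there are points on both sides of \<open>t\<close>;
      inserting them keeps \<open>Max\<close> and \<open>Min\<close> below away from the empty
      set.\<close>
    obtain l0 where "l0 < t" using lt_ex by blast
    obtain u0 where "t < u0" using gt_ex by blast
    define l where "l = Max (insert l0 {g \<in> G. g < t})"
    define u where "u = Min (insert u0 {g \<in> G. t < g})"
    have "l < t" "t < u"
      unfolding l_def u_def using assms(1) \<open>l0 < t\<close> \<open>t < u0\<close> by simp_all
    then have "\<exists>s. l < s \<and> s < u \<and> (s \<in> S) \<noteq> (t \<in> S)"
      using t unfolding frontier_pts_def by simp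
    then obtain s where s: "l < s" "s < u" "(s \<in> S) \<noteq> (t \<in> S)"
      by (elim exE conjE)
    have gap: "g \<le> l \<or> u \<le> g" if "g \<in> G" for g
      using that \<open>t \<notin> G\<close> assms(1) unfolding l_def u_def
      by (cases g t rule: linorder_cases) auto
    have lu: "l < min s t" "max s t < u"
      using s \<open>l < t\<close> \<open>t < u\<close> by simp_all
    have "g \<notin> G" if "min s t \<le> g" "g \<le> max s t" for g
    proof -
      have "l < g" using lu(1) that(1) by (rule less_le_trans)
      moreover have "g < u" using that(2) lu(2) by (rule le_less_trans)
      ultimately show ?thesis using gap[of g] by (auto dest: leD)
    qed
    then have "{min s t..max s t} \<inter> G = {}"
      by (simp add: disjoint_iff)
    then have "min s t \<in> S \<longleftrightarrow> max s t \<in> S"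
      by (intro separatesD[OF assms(2)]) (auto simp: min_le_iff_disj le_max_iff_disj)
    then show False
      using s(3) by (auto simp: min_def max_def split: if_splits)
  qed
qed

text \<open>A point \<open>g\<close> outside the frontier has a neighbourhood on which
  \<open>S\<close> is constant. By density it contains points strictly between \<open>g\<close> and
  either end, and the interval from such a point to that end avoids all of \<open>G\<close>.\<close>

lemma separates_remove:
  fixes S :: "'a::unbounded_dense_linorder set"
  assumes sep: "separates G S" and g: "g \<notin> frontier_pts S"
  shows "separates (G - {g}) S"
  unfolding separates_def
proof (intro allI impI, elim conjE)
  fix t t' assume le: "t \<le> t'" and avoid: "{t..t'} \<inter> (G - {g}) = {}"
  obtain l u where lu: "l < g" "g < u" and const: "\<And>s. l < s \<Longrightarrow> s < u \<Longrightarrow> s \<in> S \<longleftrightarrow> g \<in> S"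
    using g unfolding frontier_pts_def by blast
  show "t \<in> S \<longleftrightarrow> t' \<in> S"
  proof (cases "t \<le> g \<and> g \<le> t'")
    case False
    then have "{t..t'} \<inter> G = {}"
      using avoid by auto
    then show ?thesis by (rule separatesD[OF sep le])
  next
    case True
    have "t \<in> S \<longleftrightarrow> g \<in> S"
    proof (cases "t = g")
      case False
      then have "t < g" using True by (simp add: order.not_eq_order_implies_strict)
      then obtain s where s: "max l t < s" "s < g" using dense[of "max l t" g] lu by auto
      then have "s < t'" using True by (auto intro: less_le_trans)
      then have "{t..s} \<subseteq> {t..t'} - {g}" using s by auto
      then have "{t..s} \<inter> G = {}" using avoid by blast
      then have "t \<in> S \<longleftrightarrow> s \<in> S" using s by (intro separatesD[OF sep]) (simp_all add: less_imp_le)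
      then show ?thesis using const[of s] s lu(2) by simp
    qed simp
    moreover have "t' \<in> S \<longleftrightarrow> g \<in> S"
    proof (cases "t' = g")
      case False
      then have "g < t'" using True by (simp add: order.not_eq_order_implies_strict)
      then obtain s where s: "g < s" "s < min u t'" using dense[of g "min u t'"] lu by auto
      then have "t < s" using True by (auto intro: le_less_trans)
      then have "{s..t'} \<subseteq> {t..t'} - {g}" using s by auto
      then have "{s..t'} \<inter> G = {}" using avoid by blast
      then have "s \<in> S \<longleftrightarrow> t' \<in> S" using s by (intro separatesD[OF sep]) (simp_all add: less_imp_le)
      then show ?thesis using const[of s] s lu(1) by simp
    qed simp
    ultimately show ?thesis by simp
  qed
qed

text \<open>Start with any finite separating set and delete its non-frontier points one by one; only
  frontier points are left.\<close>

lemma frontier_pts_separates: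
  fixes S :: "'a::unbounded_dense_linorder set"
  assumes "finite_union_points_intervals S"
  shows "finite (frontier_pts S)" "separates (frontier_pts S) S"
proof -
  obtain G where G: "finite G" "separates G S"
    using finite_separator[OF assms] by blast
  have "separates (G - H) S" if "finite H" "H \<inter> frontier_pts S = {}" for H
    using that
  proof (induction H)
    case (insert g H)
    then have "separates (G - H - {g}) S"
      by (intro separates_remove) auto
    then show ?case
      by (subst Diff_insert)
  qed (simp add: G)
  from this[of "G - frontier_pts S"] have "separates (G - (G - frontier_pts S)) S"
    using G(1) by blast
  then show "separates (frontier_pts S) S"
    by (rule separates_mono) blast
  show "finite (frontier_pts S)"
    using frontier_pts_subset[OF G] G(1) finite_subset by blast
qed

section \<open>Positions relative to a finite set\<close>

definition rank_in :: "'a::linorder set \<Rightarrow> 'a \<Rightarrow> nat" where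
  "rank_in G t = card {g \<in> G. g < t}"

text \<open>The \<open>s\<close> to take is the largest element of \<open>G\<close> below
  \<open>t\<close>, which has exactly one element fewer below it. The recursion turns a bound on a
  cardinality into quantifiers, so that the bound becomes definable.\<close>

lemma Suc_le_rank_in:
  assumes "finite G"
  shows "Suc j \<le> rank_in G t \<longleftrightarrow> (\<exists>s. s \<in> G \<and> s < t \<and> j \<le> rank_in G s)"
proof
  assume *: "Suc j \<le> rank_in G t"
  let ?B = "{g \<in> G. g < t}"
  have "card ?B \<noteq> 0"
    using * unfolding rank_in_def by linarith
  then have B: "finite ?B" "?B \<noteq> {}"
    using assms by (simp, metis card.empty)
  define s where "s = Max ?B"
  have s: "s \<in> G" "s < t"
    using Max_in[OF B] unfolding s_def by simp_all
  have "?B \<subseteq> insert s {g \<in> G. g < s}"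
  proof
    fix g assume "g \<in> ?B"
    then show "g \<in> insert s {g \<in> G. g < s}"
      using Max_ge[OF B(1), of g] unfolding s_def[symmetric] by (auto dest: le_neq_trans)
  qed
  then have "card ?B \<le> card (insert s {g \<in> G. g < s})"
    using assms by (intro card_mono) auto
  then have "j \<le> rank_in G s"
    using * assms unfolding rank_in_def by simp
  then show "\<exists>s. s \<in> G \<and> s < t \<and> j \<le> rank_in G s"
    using s by blast
next
  assume "\<exists>s. s \<in> G \<and> s < t \<and> j \<le> rank_in G s"
  then obtain s where s: "s \<in> G" "s < t" "j \<le> rank_in G s" by blast
  have "card (insert s {g \<in> G. g < s}) \<le> card {g \<in> G. g < t}"
    using assms s by (intro card_mono) auto
  then show "Suc j \<le> rank_in G t"
    using s(3) assms unfolding rank_in_def by simp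
qed

text \<open>Equal cardinality turns the inclusion between the two initial segments of
  \<open>G\<close> into equality, so nothing from \<open>t\<close> up to but excluding
  \<open>t'\<close> is in \<open>G\<close>. In particular \<open>t\<close> is not, and hence neither
  is \<open>t'\<close>.\<close>

lemma same_rank_avoids:
  assumes "finite G" "t < t'" "rank_in G t = rank_in G t'" "t \<in> G \<longleftrightarrow> t' \<in> G"
  shows "{t..t'} \<inter> G = {}"
proof -
  have "{g \<in> G. g < t} = {g \<in> G. g < t'}"
  proof (rule card_subset_eq)
    show "{g \<in> G. g < t} \<subseteq> {g \<in> G. g < t'}"
      using assms(2) less_trans by blast
    show "card {g \<in> G. g < t} = card {g \<in> G. g < t'}"
      using assms(3) unfolding rank_in_def .
  qed (use assms(1) in simp)
  then have *: "g \<notin> G" if "t \<le> g" "g < t'" for g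
    using that leD by blast
  have "g \<notin> G" if "t \<le> g" "g \<le> t'" for g
    using *[of g] *[of t] assms(2,4) that by (cases "g = t'") auto
  then show ?thesis by auto
qed

section \<open>Definable predicates on environments\<close>

fun rename_term :: "(nat \<Rightarrow> nat) \<Rightarrow> 'f fo_term \<Rightarrow> 'f fo_term" where
  "rename_term f (Var v) = Var (f v)"
| "rename_term f (Fun g ts) = Fun g (map (rename_term f) ts)"

fun rename :: "(nat \<Rightarrow> nat) \<Rightarrow> ('f, 'r) formula \<Rightarrow> ('f, 'r) formula" where
  "rename f (Eq s t) = Eq (rename_term f s) (rename_term f t)"
| "rename f (Rel r ts) = Rel r (map (rename_term f) ts)"
| "rename f (Neg \<phi>) = Neg (rename f \<phi>)"
| "rename f (Conj \<phi> \<psi>) = Conj (rename f \<phi>) (rename f \<psi>)"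
| "rename f (Exists v \<phi>) = Exists (f v) (rename f \<phi>)"

lemma term_in_rename [simp]: "term_in L (rename_term f t) = term_in L t"
  by (induction t) auto

lemma formula_in_rename [simp]: "formula_in L (rename f \<phi>) = formula_in L \<phi>"
  by (induction \<phi>) auto

lemma term_val_rename: "term_val M e (rename_term f t) = term_val M (e \<circ> f) t"
proof (induction t)
  case (Fun g ts)
  then have "map (term_val M e \<circ> rename_term f) ts = map (term_val M (e \<circ> f)) ts"
    by (simp only: map_eq_conv comp_apply[of "term_val M e"]) blast
  then show ?case by (simp only: rename_term.simps term_val.simps map_map)
qed simp

text \<open>Injectivity keeps the update at \<open>f v\<close> from changing the value of any other
  renamed variable, so no variable is captured.\<close>

lemma sat_rename:
  assumes "inj f"
  shows "sat M e (rename f \<phi>) = sat M (e \<circ> f) \<phi>"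
proof (induction \<phi> arbitrary: e)
  case (Exists v \<phi>)
  have eq: "e(f v := m) \<circ> f = (e \<circ> f)(v := m)" for m
    using assms by (auto simp: fun_eq_iff inj_eq)
  show ?case by (simp only: rename.simps sat.simps Exists.IH eq)
qed (simp_all add: term_val_rename o_def)

lemma finite_term_vars: "finite (term_vars t)"
  by (induction t) auto

lemma finite_free_vars: "finite (free_vars \<phi>)"
  by (induction \<phi>) (auto simp: finite_term_vars)

text \<open>Substitutes variable \<open>0\<close> for those in \<open>vs\<close>, by quantifying
  each of them and equating it with variable \<open>0\<close>. An injective renaming could not merge
  variables.\<close>

definition identify :: "nat list \<Rightarrow> ('f, 'r) formula \<Rightarrow> ('f, 'r) formula" where
  "identify vs \<phi> = foldr (\<lambda>v \<chi>. Exists v (Conj (Eq (Var 0) (Var v)) \<chi>)) vs \<phi>"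

lemma formula_in_identify [simp]: "formula_in L (identify vs \<phi>) = formula_in L \<phi>"
  unfolding identify_def by (induction vs) auto

lemma sat_identify:
  assumes "0 \<notin> set vs"
  shows "sat M e (identify vs \<phi>) = sat M (\<lambda>v. if v \<in> set vs then e 0 else e v) \<phi>"
  using assms
proof (induction vs arbitrary: e)
  case (Cons w vs)
  have "sat M e (identify (w # vs) \<phi>) = sat M (e(w := e 0)) (identify vs \<phi>)"
    using Cons.prems by (auto simp: identify_def)
  also have "\<dots> = sat M (\<lambda>v. if v \<in> set vs then (e(w := e 0)) 0 else (e(w := e 0)) v) \<phi>"
    using Cons by simp
  also have "(\<lambda>v. if v \<in> set vs then (e(w := e 0)) 0 else (e(w := e 0)) v) =
      (\<lambda>v. if v \<in> set (w # vs) then e 0 else e v)"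
    using Cons.prems by (auto simp: fun_eq_iff)
  finally show ?case .
qed (simp add: identify_def)

text \<open>An entry of the environment or a parameter. Function symbols stay inside formulas, so
  this class is closed under substitution.\<close>

definition simple_term :: "((nat \<Rightarrow> 'm) \<Rightarrow> 'm) \<Rightarrow> bool" where
  "simple_term \<tau> \<longleftrightarrow> (\<exists>k. \<tau> = (\<lambda>e. e k)) \<or> (\<exists>c. \<tau> = (\<lambda>_. c))"

lemma simple_term_var [intro!]: "simple_term (\<lambda>e. e k)"
  and simple_term_const [intro!]: "simple_term (\<lambda>_. c)"
  unfolding simple_term_def by blast+

lemma simple_term_subst:
  assumes "simple_term \<tau>" "\<And>k. simple_term (\<rho> k)"
  shows "simple_term (\<lambda>e. \<tau> (\<lambda>k. \<rho> k e))"
  using assms(1) unfolding simple_term_def[of \<tau>] by (auto simp: assms(2))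

lemma simple_term_shift [intro]:
  "simple_term \<tau> \<Longrightarrow> simple_term (\<lambda>e. \<tau> (\<lambda>k. e (f k)))"
  by (rule simple_term_subst) auto

definition simple_tuple :: "nat \<Rightarrow> ((nat \<Rightarrow> 'm) \<Rightarrow> 'm list) \<Rightarrow> bool" where
  "simple_tuple n \<alpha> \<longleftrightarrow>
     (\<exists>\<tau>s. length \<tau>s = n \<and> (\<forall>\<tau>\<in>set \<tau>s. simple_term \<tau>) \<and> \<alpha> = (\<lambda>e. map (\<lambda>\<tau>. \<tau> e) \<tau>s))"

lemma simple_tuple_const: "length c = n \<Longrightarrow> simple_tuple n (\<lambda>_. c)"
  unfolding simple_tuple_def
  by (intro exI[of _ "map (\<lambda>a _. a) c"]) (auto simp: o_def)

lemma simple_tuple_vars: "length ks = n \<Longrightarrow> simple_tuple n (\<lambda>e. map e ks)"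
  unfolding simple_tuple_def
  by (intro exI[of _ "map (\<lambda>k e. e k) ks"]) (auto simp: o_def)

lemma simple_tuple_Cons:
  "simple_term \<tau> \<Longrightarrow> simple_tuple n \<alpha> \<Longrightarrow> simple_tuple (Suc n) (\<lambda>e. \<tau> e # \<alpha> e)"
  unfolding simple_tuple_def
  by (elim exE) (rule_tac x = "\<tau> # \<tau>s" in exI, auto)

lemma simple_tuple_take:
  "simple_tuple (n + m) \<alpha> \<Longrightarrow> simple_tuple n (\<lambda>e. take n (\<alpha> e))"
  unfolding simple_tuple_def
  by (elim exE) (rule_tac x = "take n \<tau>s" in exI, auto simp: take_map dest: in_set_takeD)

lemma simple_tuple_drop:
  "simple_tuple (n + m) \<alpha> \<Longrightarrow> simple_tuple m (\<lambda>e. drop n (\<alpha> e))"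
  unfolding simple_tuple_def
  by (elim exE) (rule_tac x = "drop n \<tau>s" in exI, auto simp: drop_map dest: in_set_dropD)

lemma simple_tuple_shift:
  assumes "simple_tuple n \<alpha>"
  shows "simple_tuple n (\<lambda>e. \<alpha> (\<lambda>k. e (f k)))"
proof -
  obtain \<tau>s where "length \<tau>s = n" "\<forall>\<tau>\<in>set \<tau>s. simple_term \<tau>" "\<alpha> = (\<lambda>e. map (\<lambda>\<tau>. \<tau> e) \<tau>s)"
    using assms unfolding simple_tuple_def by blast
  then show ?thesis
    unfolding simple_tuple_def
    by (intro exI[of _ "map (\<lambda>\<tau> e. \<tau> (\<lambda>k. e (f k))) \<tau>s"]) (auto simp: o_def)
qed

lemma length_simple_tuple: "simple_tuple n \<alpha> \<Longrightarrow> length (\<alpha> e) = n"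
  unfolding simple_tuple_def by auto

section \<open>Closure properties of definable predicates\<close>

locale o_minimal_structure =
  fixes L :: "('f, 'r) language"
    and M :: "('f, 'r, 'm::unbounded_dense_linorder) fo_structure"
  assumes o_minimal: "o_minimal L M"
begin

text \<open>
  Each variable of \<open>\<psi>\<close> is read off the environment or replaced by a parameter. Distinct variables of \<open>\<psi>\<close> may
  read the same entry, so substitution is mere composition. A predicate with one more argument \<open>t\<close> is
  handled in de Bruijn style, with \<open>t\<close> pushed in front of the environment (\<open>case_nat t e\<close>).
\<close>

definition definable_pred :: "((nat \<Rightarrow> 'm) \<Rightarrow> bool) \<Rightarrow> bool" where
  "definable_pred Q \<longleftrightarrow>
     (\<exists>\<psi> \<tau>. formula_in L \<psi> \<and> (\<forall>v. simple_term (\<tau> v)) \<and> Q = (\<lambda>e. sat M (\<lambda>v. \<tau> v e) \<psi>))"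

lemma definable_predI:
  "formula_in L \<psi> \<Longrightarrow> (\<And>v. simple_term (\<tau> v)) \<Longrightarrow> definable_pred (\<lambda>e. sat M (\<lambda>v. \<tau> v e) \<psi>)"
  unfolding definable_pred_def by blast

lemma definable_predE:
  assumes "definable_pred Q"
  obtains \<psi> \<tau> where "formula_in L \<psi>" "\<And>v. simple_term (\<tau> v)" "\<And>e. Q e = sat M (\<lambda>v. \<tau> v e) \<psi>"
  using assms unfolding definable_pred_def by auto

lemma definable_pred_subst:
  assumes "definable_pred Q" "\<And>k. simple_term (\<rho> k)"
  shows "definable_pred (\<lambda>e. Q (\<lambda>k. \<rho> k e))"
proof -
  obtain \<psi> \<tau> where *: "formula_in L \<psi>" "\<And>v. simple_term (\<tau> v)" "\<And>e. Q e = sat M (\<lambda>v. \<tau> v e) \<psi>"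
    using assms(1) by (rule definable_predE) auto
  show ?thesis
    unfolding *(3) by (rule definable_predI[OF *(1)]) (rule simple_term_subst[OF *(2) assms(2)])
qed

lemma definable_pred_not:
  assumes "definable_pred Q"
  shows "definable_pred (\<lambda>e. \<not> Q e)"
proof -
  obtain \<psi> \<tau> where *: "formula_in L \<psi>" "\<And>v. simple_term (\<tau> v)" "\<And>e. Q e = sat M (\<lambda>v. \<tau> v e) \<psi>"
    using assms by (rule definable_predE) auto
  have "definable_pred (\<lambda>e. sat M (\<lambda>v. \<tau> v e) (Neg \<psi>))"
    by (rule definable_predI) (simp_all add: *)
  then show ?thesis
    by (simp add: *(3))
qed

text \<open>The two formulas may read different terms at the same variable. Moving their variables
  to even and odd numbers keeps the two assignments apart.\<close>

lemma definable_pred_conj: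
  assumes "definable_pred P" "definable_pred Q"
  shows "definable_pred (\<lambda>e. P e \<and> Q e)"
proof -
  obtain \<psi> \<tau> where P: "formula_in L \<psi>" "\<And>v. simple_term (\<tau> v)" "\<And>e. P e = sat M (\<lambda>v. \<tau> v e) \<psi>"
    using assms(1) by (rule definable_predE) auto
  obtain \<chi> \<sigma> where Q: "formula_in L \<chi>" "\<And>v. simple_term (\<sigma> v)" "\<And>e. Q e = sat M (\<lambda>v. \<sigma> v e) \<chi>"
    using assms(2) by (rule definable_predE) auto
  define \<rho> where "\<rho> v = (if even v then \<tau> (v div 2) else \<sigma> (v div 2))" for v
  let ?\<theta> = "Conj (rename (\<lambda>v. 2 * v) \<psi>) (rename (\<lambda>v. 2 * v + 1) \<chi>)"
  have "definable_pred (\<lambda>e. sat M (\<lambda>v. \<rho> v e) ?\<theta>)"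
    by (rule definable_predI) (simp_all add: P Q \<rho>_def)
  moreover have "sat M (\<lambda>v. \<rho> v e) ?\<theta> \<longleftrightarrow> P e \<and> Q e" for e
    by (simp add: sat_rename inj_on_def o_def P Q \<rho>_def)
  ultimately show ?thesis by simp
qed

lemma definable_pred_iff:
  assumes "definable_pred P" "definable_pred Q"
  shows "definable_pred (\<lambda>e. P e \<longleftrightarrow> Q e)"
proof -
  have "(\<lambda>e. P e \<longleftrightarrow> Q e) = (\<lambda>e. \<not> (P e \<and> \<not> Q e) \<and> \<not> (Q e \<and> \<not> P e))"
    by blast
  then show ?thesis
    by (simp only:) (intro definable_pred_not definable_pred_conj assms)
qed

lemma definable_pred_less:
  assumes "simple_term \<sigma>" "simple_term \<tau>"
  shows "definable_pred (\<lambda>e. \<sigma> e < \<tau> e)"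
proof -
  obtain lt where lt: "(lt, 2) \<in> rels L" "\<And>a b. rel_interp M lt [a, b] \<longleftrightarrow> a < b"
    using o_minimal unfolding o_minimal_def expands_order_def by blast
  have "definable_pred (\<lambda>e. sat M (\<lambda>v. (if v = 0 then \<sigma> else \<tau>) e) (Rel lt [Var 0, Var 1]))"
    by (rule definable_predI) (simp_all add: lt assms numeral_2_eq_2[symmetric])
  then show ?thesis
    by (simp add: lt)
qed

text \<open>The variables reading entry \<open>0\<close> must be merged into one before it can be quantified.\<close>

lemma definable_pred_var0:
  assumes "definable_pred Q"
  obtains \<theta> \<rho> where "formula_in L \<theta>" "\<And>v. simple_term (\<rho> v)"
    "\<And>t e. Q (case_nat t e) = sat M (case_nat t (\<lambda>v. \<rho> v e)) \<theta>"
proof -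
  obtain \<psi> \<tau> where Q: "formula_in L \<psi>" "\<And>v. simple_term (\<tau> v)" "\<And>e. Q e = sat M (\<lambda>v. \<tau> v e) \<psi>"
    using assms by (rule definable_predE) auto
  have "\<exists>r. simple_term r \<and> (\<tau> v \<noteq> (\<lambda>e. e 0) \<longrightarrow> (\<forall>t e. \<tau> v (case_nat t e) = r e))" for v
  proof -
    consider "\<tau> v = (\<lambda>e. e 0)" | k where "\<tau> v = (\<lambda>e. e (Suc k))" | c where "\<tau> v = (\<lambda>_. c)"
      using Q(2)[of v] unfolding simple_term_def by (metis not0_implies_Suc)
    then show ?thesis
      by cases (rule exI[of _ "\<lambda>e. e 0"], force, rule_tac x = "\<lambda>e. e k" in exI, force,
        rule_tac x = "\<lambda>_. c" in exI, force)
  qed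
  \<comment> \<open>\<open>\<rho>\<close> reads the environment without its new front entry; at
    variables that read entry \<open>0\<close> it is arbitrary.\<close>
  then obtain \<rho> where \<rho>: "\<And>v. simple_term (\<rho> v)"
    "\<And>v t e. \<tau> v \<noteq> (\<lambda>e. e 0) \<Longrightarrow> \<tau> v (case_nat t e) = \<rho> v e"
    by metis
  \<comment> \<open>Infinitely many variables may read entry \<open>0\<close>; only the finitely
    many free ones are merged.\<close>
  obtain vs where vs: "set vs = {v \<in> free_vars \<psi>. \<tau> v = (\<lambda>e. e 0)}"
    using finite_list[of "{v \<in> free_vars \<psi>. \<tau> v = (\<lambda>e. e 0)}"] by (auto simp: finite_free_vars)
  \<comment> \<open>Shifting every variable by one leaves variable \<open>0\<close> available to
    carry \<open>t\<close>.\<close>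
  define \<theta> where "\<theta> = identify (map Suc vs) (rename Suc \<psi>)"
  have "Q (case_nat t e) = sat M (case_nat t (\<lambda>v. \<rho> v e)) \<theta>" for t e
  proof -
    have "sat M (case_nat t (\<lambda>v. \<rho> v e)) \<theta> = sat M (\<lambda>v. if v \<in> set vs then t else \<rho> v e) \<psi>"
    proof -
      have zero: "0 \<notin> set (map Suc vs)" by auto
      have eq: "(\<lambda>v. if v \<in> set (map Suc vs) then case_nat t (\<lambda>v. \<rho> v e) 0 else case_nat t (\<lambda>v. \<rho> v e) v) \<circ> Suc =
          (\<lambda>v. if v \<in> set vs then t else \<rho> v e)"
        by (auto simp: fun_eq_iff)
      show ?thesis
        unfolding \<theta>_def sat_identify[OF zero] sat_rename[OF inj_Suc] eq ..
    qed
    also have "\<dots> = sat M (\<lambda>v. \<tau> v (case_nat t e)) \<psi>"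
      by (rule sat_cong) (auto simp: vs \<rho>(2))
    finally show ?thesis by (simp add: Q(3))
  qed
  then show thesis
    using that[of \<theta> \<rho>] Q(1) \<rho>(1) by (simp add: \<theta>_def)
qed

lemma definable_pred_ex:
  assumes "definable_pred (\<lambda>e. P (\<lambda>k. e (Suc k)) (e 0))"
  shows "definable_pred (\<lambda>e. \<exists>t. P e t)"
proof -
  obtain \<theta> \<rho> where *: "formula_in L \<theta>" "\<And>v. simple_term (\<rho> v)"
    "\<And>t e. P (\<lambda>k. case_nat t e (Suc k)) (case_nat t e 0) = sat M (case_nat t (\<lambda>v. \<rho> v e)) \<theta>"
    using assms by (rule definable_pred_var0) auto
  \<comment> \<open>The value given to variable \<open>0\<close> is a dummy: the quantifier
    overwrites it.\<close>
  have "definable_pred (\<lambda>e. sat M (\<lambda>v. case_nat (\<lambda>e. e 0) \<rho> v e) (Exists 0 \<theta>))"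
    using *(1,2) by (intro definable_predI[of _ "case_nat (\<lambda>e. e 0) \<rho>"]) (auto split: nat.split)
  moreover have "(\<lambda>v. case_nat (\<lambda>e. e 0) \<rho> v e)(0 := t) = case_nat t (\<lambda>v. \<rho> v e)" for t e
    by (auto simp: fun_eq_iff split: nat.split)
  ultimately show ?thesis
    using *(3) by simp
qed

text \<open>The outermost quantifier binds the first coordinate and the later ones push it deeper,
  so the coordinates sit in the entries in reverse order.\<close>

lemma definable_pred_ex_tuple:
  assumes "definable_pred (\<lambda>e. P (\<lambda>k. e (k + n)) (map e (rev [0..<n])))"
  shows "definable_pred (\<lambda>e. \<exists>a\<in>tuples n. P e a)"
  using assms
proof (induction n arbitrary: P)
  case 0
  then show ?case by (simp add: tuples_def)
next
  case (Suc n)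
  have "definable_pred (\<lambda>e. \<exists>a\<in>tuples n. P (\<lambda>k. e (Suc k)) (e 0 # a))"
    by (rule Suc.IH) (use Suc.prems in \<open>simp\<close>)
  then have "definable_pred (\<lambda>e. \<exists>t. \<exists>a\<in>tuples n. P e (t # a))"
    by (rule definable_pred_ex)
  moreover have "(\<exists>a\<in>tuples (Suc n). R a) \<longleftrightarrow> (\<exists>t. \<exists>a\<in>tuples n. R (t # a))" for R :: "'m list \<Rightarrow> bool"
    by (auto simp: tuples_def length_Suc_conv)
  ultimately show ?case by simp
qed

lemma definable_pred_holds_at:
  assumes "formula_in L \<psi>" "simple_tuple n \<alpha>" "simple_tuple m \<beta>"
  shows "definable_pred (\<lambda>e. holds_at M \<psi> x y (\<alpha> e) (\<beta> e))"
proof -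
  obtain \<sigma>s \<tau>s where
      \<alpha>: "\<forall>\<tau>\<in>set \<sigma>s. simple_term \<tau>" "\<alpha> = (\<lambda>e. map (\<lambda>\<tau>. \<tau> e) \<sigma>s)" and
      \<beta>: "\<forall>\<tau>\<in>set \<tau>s. simple_term \<tau>" "\<beta> = (\<lambda>e. map (\<lambda>\<tau>. \<tau> e) \<tau>s)"
    using assms(2,3) unfolding simple_tuple_def by blast
  \<comment> \<open>Lookup commutes with evaluation, so the term that a variable reads does not
    depend on \<open>e\<close>. A variable that is not found reads \<open>the None\<close>, a
    constant.\<close>
  have eq: "map_of (zip (x @ y) (\<alpha> e @ \<beta> e)) v =
      map_option (\<lambda>\<tau>. \<tau> e) (map_of (zip (x @ y) (\<sigma>s @ \<tau>s)) v)" for e v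
    unfolding \<alpha>(2) \<beta>(2) map_append[symmetric] zip_map2 by (simp add: map_of_map)
  have "simple_term (\<lambda>e. the (map_of (zip (x @ y) (\<alpha> e @ \<beta> e)) v))" for v
  proof (cases "map_of (zip (x @ y) (\<sigma>s @ \<tau>s)) v")
    case None
    then show ?thesis unfolding eq by auto
  next
    case (Some \<tau>)
    then have "\<tau> \<in> set (\<sigma>s @ \<tau>s)"
      by (meson map_of_SomeD set_zip_rightD)
    then show ?thesis
      unfolding eq Some using \<alpha>(1) \<beta>(1) by auto
  qed
  then show ?thesis
    unfolding holds_at_def by (rule definable_predI[OF assms(1)])
qed

lemma definable_pred_mem:
  assumes "definable L M n A" "simple_tuple n \<alpha>"
  shows "definable_pred (\<lambda>e. \<alpha> e \<in> A)"
proof -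
  obtain \<psi> x z c where *: "formula_in L \<psi>" "A = {a \<in> tuples n. holds_at M \<psi> x z a c}"
    using assms(1) unfolding definable_def partitioned_formula_def by blast
  have "definable_pred (\<lambda>e. holds_at M \<psi> x z (\<alpha> e) c)"
    by (rule definable_pred_holds_at[OF *(1) assms(2) simple_tuple_const[OF refl]])
  then show ?thesis
    using length_simple_tuple[OF assms(2)] by (simp add: *(2) tuples_def)
qed

text \<open>O-minimality speaks of finite parameter tuples. One is obtained by listing the values of
  the free variables other than \<open>0\<close>, which carries \<open>t\<close>.\<close>

lemma o_minimal_section:
  assumes "definable_pred Q"
  shows "finite_union_points_intervals {t. Q (case_nat t e)}"
proof -
  obtain \<theta> \<rho> where *: "formula_in L \<theta>"
    "\<And>t e. Q (case_nat t e) = sat M (case_nat t (\<lambda>v. \<rho> v e)) \<theta>"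
    using assms by (rule definable_pred_var0) auto
  obtain z where z: "set z = free_vars \<theta> - {0}" "distinct z"
    using finite_distinct_list[of "free_vars \<theta> - {0}"] finite_free_vars by auto
  define env where "env t = case_nat t (\<lambda>v. \<rho> v e)" for t
  \<comment> \<open>\<open>z\<close> omits variable \<open>0\<close>, so \<open>undefined\<close>
    does not enter \<open>c\<close>.\<close>
  define c where "c = map (env undefined) z"
  have "holds_at M \<theta> [0] z [t] c = sat M (env t) \<theta>" for t
    unfolding holds_at_def
  proof (rule sat_cong, rule ballI)
    fix v assume "v \<in> free_vars \<theta>"
    then show "the (map_of (zip ([0] @ z) ([t] @ c)) v) = env t v"
      using z(1) by (cases v) (auto simp: c_def env_def map_of_zip_map)
  qed
  moreover have "definable L M 1 {a \<in> tuples 1. holds_at M \<theta> [0] z a c}"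
    unfolding definable_def partitioned_formula_def
    by (rule exI[of _ \<theta>], rule exI[of _ "[0]"], rule exI[of _ z], rule exI[of _ c])
       (use z *(1) in \<open>auto simp: c_def\<close>)
  ultimately show ?thesis
    using o_minimal unfolding o_minimal_def *(2) env_def by (fastforce simp: tuples_def)
qed

section \<open>Uniformly definable families of subsets of the line\<close>

definition definable_family :: "((nat \<Rightarrow> 'm) \<Rightarrow> 'm set) \<Rightarrow> bool" where
  "definable_family S \<longleftrightarrow> definable_pred (\<lambda>e. e 0 \<in> S (\<lambda>k. e (Suc k)))"

text \<open>The map \<open>f\<close> re-indexes the environment, so that membership can be used
  under quantifiers, where the parameters of the family have moved deeper.\<close>

lemma definable_familyD:
  assumes "definable_family S" "simple_term \<tau>"
  shows "definable_pred (\<lambda>e. \<tau> e \<in> S (\<lambda>k. e (f k)))"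
proof -
  have "definable_pred (\<lambda>e. case_nat \<tau> (\<lambda>k e. e (f k)) 0 e \<in> S (\<lambda>k. case_nat \<tau> (\<lambda>k e. e (f k)) (Suc k) e))"
    by (rule definable_pred_subst[OF assms(1)[unfolded definable_family_def]])
       (use assms(2) in \<open>auto split: nat.split\<close>)
  then show ?thesis by simp
qed

lemmas definable_family_mem = definable_familyD[where f = "\<lambda>k. k"]

lemma definable_family_tame:
  assumes "definable_family S"
  shows "finite_union_points_intervals (S e)"
  using o_minimal_section[OF assms[unfolded definable_family_def], of e] by simp

lemmas finite_frontier_family = frontier_pts_separates(1)[OF definable_family_tame]
lemmas separates_frontier_family = frontier_pts_separates(2)[OF definable_family_tame]

lemmas definable_pred_intros =
  definable_pred_not definable_pred_conj definable_pred_iff definable_pred_ex definable_pred_less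
  simple_term_var

lemma definable_family_frontier:
  assumes "definable_family S"
  shows "definable_family (\<lambda>e. frontier_pts (S e))"
proof -
  have eq: "t \<in> frontier_pts X \<longleftrightarrow> \<not> (\<exists>l u. (l < t \<and> t < u) \<and>
      \<not> (\<exists>s. l < s \<and> s < u \<and> \<not> (s \<in> X \<longleftrightarrow> t \<in> X)))" for t and X :: "'m set"
    unfolding frontier_pts_def by blast
  show ?thesis
    unfolding definable_family_def eq
    by (intro definable_pred_intros definable_familyD[OF assms])
qed

text \<open>Induction through \<open>Suc_le_rank_in\<close>: each unit of rank costs one more
  existential quantifier. At rank \<open>0\<close> a tautology is needed, and the irreflexivity of
  \<open><\<close> supplies one.\<close>

lemma definable_family_rank_ge:
  assumes "definable_family S" "\<And>e. finite (S e)"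
  shows "definable_family (\<lambda>e. {t. j \<le> rank_in (S e) t})"
proof (induction j)
  case 0
  have "definable_pred (\<lambda>e. \<not> (e 0 < e 0))"
    by (intro definable_pred_intros)
  then show ?case by (simp add: definable_family_def)
next
  case (Suc j)
  have eq: "t \<in> {t. Suc j \<le> rank_in (S e) t} \<longleftrightarrow>
      (\<exists>s. s \<in> S e \<and> s < t \<and> s \<in> {t. j \<le> rank_in (S e) t})" for t e
    using Suc_le_rank_in[OF assms(2)] by simp
  show ?case
    unfolding definable_family_def eq
    by (intro definable_pred_intros definable_familyD[OF assms(1)] definable_familyD[OF Suc.IH])
qed

text \<open>A finite \<open>G\<close> cuts the line into points and gaps. The cell is the point of
  \<open>G\<close> (\<open>q\<close> true) or the gap (\<open>q\<close> false) with exactly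
  \<open>j\<close> points of \<open>G\<close> below, and empty if there is none.\<close>

definition cell :: "bool \<Rightarrow> nat \<Rightarrow> 'm set \<Rightarrow> 'm set" where
  "cell q j G = {t. (t \<in> G \<longleftrightarrow> q) \<and> rank_in G t = j}"

lemma definable_family_cell:
  assumes "definable_family S" "\<And>e. finite (S e)"
  shows "definable_family (\<lambda>e. cell q j (S e))"
proof -
  have eq: "t \<in> cell q j (S e) \<longleftrightarrow> (if q then t \<in> S e else \<not> t \<in> S e) \<and>
      t \<in> {t. j \<le> rank_in (S e) t} \<and> \<not> t \<in> {t. Suc j \<le> rank_in (S e) t}" for t e
    unfolding cell_def by auto
  show ?thesis
    unfolding definable_family_def eq
    by (cases q; simp only: if_True if_False simp_thms)
       (intro definable_pred_intros definable_familyD[OF assms(1)]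
         definable_familyD[OF definable_family_rank_ge[OF assms]])+
qed

lemma cell_avoids:
  assumes "finite G" "t \<in> cell q j G" "t' \<in> cell q j G" "t \<noteq> t'"
  shows "{min t t'..max t t'} \<inter> G = {}"
  using same_rank_avoids[OF assms(1), of t t'] same_rank_avoids[OF assms(1), of t' t] assms(2-4)
  unfolding cell_def by (cases t t' rule: linorder_cases) (auto simp: min_def max_def)

section \<open>Counting traces\<close>

text \<open>Definability is assumed for every substitution of simple tuples, not through given
  formulas. The induction hypothesis then applies to a set and a predicate built from
  \<open>A\<close> and \<open>\<phi>\<close> by the closure rules alone.\<close>

lemma traces_le:
  assumes "\<And>\<alpha>. simple_tuple n \<alpha> \<Longrightarrow> definable_pred (\<lambda>e. \<alpha> e \<in> A)"
    and "A \<subseteq> tuples n" "infinite A"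
    and "\<And>\<alpha> \<beta>. simple_tuple n \<alpha> \<Longrightarrow> simple_tuple m \<beta> \<Longrightarrow> definable_pred (\<lambda>e. \<phi> (\<alpha> e) (\<beta> e))"
  shows "|(\<lambda>b. {a \<in> A. \<phi> a b}) ` tuples m| \<le>o |A|"
  using assms
proof (induction m arbitrary: n A \<phi>)
  case 0
  have "tuples 0 = {[] :: 'm list}"
    by (auto simp: tuples_def)
  then show ?case
    using 0 by (auto intro!: card_of_singl_ordLeq)
next
  case (Suc m)
  note A = Suc.prems(1-3) and \<phi> = Suc.prems(4)
  define F where "F a b = {t. \<phi> a (t # b)}" for a b
  define E where "E b = (\<Union>a\<in>A. frontier_pts (F a b))" for b
  \<comment> \<open>One name for both frontiers, so that cells of either kind are indexed by the
    same countable type.\<close>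
  define G where "G p a b = (if p then frontier_pts (F a b) else frontier_pts (E b))" for p a b

  have F: "definable_family (\<lambda>e. F (\<alpha> e) (\<beta> e))" if "simple_tuple n \<alpha>" "simple_tuple m \<beta>" for \<alpha> \<beta>
    unfolding definable_family_def F_def mem_Collect_eq
    by (rule \<phi>, rule simple_tuple_shift[OF that(1)], rule simple_tuple_Cons,
        rule simple_term_var, rule simple_tuple_shift[OF that(2)])
  have E: "definable_family (\<lambda>e. E (\<beta> e))" if "simple_tuple m \<beta>" for \<beta>
  proof -
    have eq: "t \<in> E b \<longleftrightarrow> (\<exists>a\<in>tuples n. a \<in> A \<and> t \<in> frontier_pts (F a b))" for t b
      using A(2) unfolding E_def by blast
    \<comment> \<open>Inside the \<open>n\<close> quantifiers for the coordinates of
      \<open>a\<close>, the point \<open>t\<close> has moved to entry \<open>n\<close> and the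
      parameters start at entry \<open>Suc n\<close>.\<close>
    have *: "definable_family (\<lambda>e. frontier_pts (F (map e (rev [0..<n])) (\<beta> (\<lambda>k. e (Suc k + n)))))"
      by (rule definable_family_frontier, rule F, rule simple_tuple_vars, simp,
          rule simple_tuple_shift[OF that])
    show ?thesis
      unfolding definable_family_def eq
      by (rule definable_pred_ex_tuple, rule definable_pred_conj, rule A, rule simple_tuple_vars, simp,
          rule definable_family_mem[OF *], rule simple_term_var)
  qed
  have G: "definable_family (\<lambda>e. G p (\<alpha> e) (\<beta> e))" if "simple_tuple n \<alpha>" "simple_tuple m \<beta>" for p \<alpha> \<beta>
    unfolding G_def using F[OF that] E[OF that(2)] by (cases p) (simp_all add: definable_family_frontier)

  have tame: "finite (frontier_pts (F a b))" "separates (frontier_pts (F a b)) (F a b)"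
      "finite (frontier_pts (E b))" "separates (frontier_pts (E b)) (E b)"
    if "a \<in> tuples n" "b \<in> tuples m" for a b
  proof -
    have *: "simple_tuple n (\<lambda>_. a)" "simple_tuple m (\<lambda>_. b)"
      using that by (auto simp: tuples_def intro: simple_tuple_const)
    show "finite (frontier_pts (F a b))" "separates (frontier_pts (F a b)) (F a b)"
      using finite_frontier_family[OF F[OF *]] separates_frontier_family[OF F[OF *]] by auto
    show "finite (frontier_pts (E b))" "separates (frontier_pts (E b)) (E b)"
      using finite_frontier_family[OF E[OF *(2)]] separates_frontier_family[OF E[OF *(2)]] by auto
  qed
  then have finite_G: "finite (G p a b)" if "a \<in> tuples n" "b \<in> tuples m" for p a b
    using that unfolding G_def by simp

  define sel where "sel i a b = (case i of (p, q, j) \<Rightarrow> cell q j (G p a b))"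
    for i :: "bool \<times> bool \<times> nat" and a b
  have sel: "\<exists>i. \<exists>a\<in>A. t \<in> sel i a b \<and> (\<forall>t'\<in>sel i a b. \<forall>x\<in>A. \<phi> x (t' # b) \<longleftrightarrow> \<phi> x (t # b))"
    if b: "b \<in> tuples m" for t b
  proof (cases "t \<in> E b")
    case True
    then obtain a where a: "a \<in> A" "t \<in> G True a b"
      unfolding E_def G_def by auto
    define i where "i = (True, True, rank_in (G True a b) t)"
    have t: "t \<in> sel i a b"
      using a by (simp add: i_def sel_def cell_def)
    \<comment> \<open>Two points of this cell would bound an interval that misses the frontier of
      \<open>F a b\<close> and yet contains its member \<open>t\<close>.\<close>
    moreover have "t' = t" if "t' \<in> sel i a b" for t'
    proof (rule ccontr)
      assume "t' \<noteq> t"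
      then have "{min t t'..max t t'} \<inter> G True a b = {}"
        using t that a A(2) finite_G[OF _ b] unfolding i_def sel_def by (intro cell_avoids) auto
      moreover have "t \<in> {min t t'..max t t'}" by simp
      ultimately show False using a(2) by blast
    qed
    ultimately show ?thesis
      using a(1) by blast
  next
    case False
    \<comment> \<open>The cell is cut out by the frontier of \<open>E b\<close> alone, so any point
      of \<open>A\<close> will do.\<close>
    obtain a where a: "a \<in> A" using A(3) by fastforce
    define i where "i = (False, t \<in> G False a b, rank_in (G False a b) t)"
    have t: "t \<in> sel i a b"
      by (simp add: i_def sel_def cell_def)
    moreover have "\<phi> x (t' # b) \<longleftrightarrow> \<phi> x (t # b)" if t': "t' \<in> sel i a b" and x: "x \<in> A" for t' x
    proof (cases "t' = t")
      case False
      have aT: "a \<in> tuples n" and xT: "x \<in> tuples n" using a x A(2) by auto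
      have avoid: "{min t t'..max t t'} \<inter> frontier_pts (E b) = {}"
      proof (rule cell_avoids[OF tame(3)[OF aT b]])
        show "t \<in> cell (t \<in> G False a b) (rank_in (G False a b) t) (frontier_pts (E b))"
          using t unfolding i_def sel_def by (simp add: G_def)
        show "t' \<in> cell (t \<in> G False a b) (rank_in (G False a b) t) (frontier_pts (E b))"
          using t' unfolding i_def sel_def by (simp add: G_def)
      qed (use False in simp)
      \<comment> \<open>Membership in \<open>E b\<close> is constant between \<open>t\<close> and
        \<open>t'\<close>, as no frontier point of \<open>E b\<close> lies there, and
        \<open>t\<close> is outside \<open>E b\<close>. Hence no \<open>F x b\<close> has a frontier
        point there either.\<close>
      have "s \<notin> E b" if "min t t' \<le> s" "s \<le> max t t'" for s
      proof -
        have "{min s t..max s t} \<subseteq> {min t t'..max t t'}"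
          using that by simp
        then have "{min s t..max s t} \<inter> frontier_pts (E b) = {}"
          using avoid by blast
        then have "min s t \<in> E b \<longleftrightarrow> max s t \<in> E b"
          by (rule separatesD[OF tame(4)[OF aT b], rotated]) (simp add: min_le_iff_disj le_max_iff_disj)
        then show ?thesis
          using \<open>t \<notin> E b\<close> by (auto simp: min_def max_def split: if_splits)
      qed
      then have "s \<notin> frontier_pts (F x b)" if "min t t' \<le> s" "s \<le> max t t'" for s
        using x that unfolding E_def by blast
      then have "{min t t'..max t t'} \<inter> frontier_pts (F x b) = {}"
        by (simp add: disjoint_iff)
      then have "min t t' \<in> F x b \<longleftrightarrow> max t t' \<in> F x b"
        by (rule separatesD[OF tame(2)[OF xT b], rotated]) (simp add: min_le_iff_disj le_max_iff_disj)
      then show ?thesis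
        unfolding F_def by (auto simp: min_def max_def split: if_splits)
    qed simp
    ultimately show ?thesis
      using a by blast
  qed

  \<comment> \<open>Concatenations stand for pairs, because the induction hypothesis concerns sets
    of tuples of one length.\<close>
  define A2 where "A2 = {l \<in> tuples (n + n). take n l \<in> A \<and> drop n l \<in> A}"
  \<comment> \<open>The coordinate \<open>t\<close> is no longer a parameter but quantified over its
    cell; for the cells provided by \<open>sel\<close>, which point is taken makes no difference to
    the trace.\<close>
  define \<psi> where "\<psi> i l b = (\<exists>t. t \<in> sel i (drop n l) b \<and> \<phi> (take n l) (t # b))" for i l b
  define T where "T i = (\<lambda>b. {l \<in> A2. \<psi> i l b}) ` tuples m" for i
  have A2_append: "x @ a \<in> A2" if "x \<in> A" "a \<in> A" for x a
  proof -
    have "length x = n" "length a = n" using that A(2) by (auto simp: tuples_def)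
    then show ?thesis using that by (simp add: A2_def tuples_def)
  qed
  have T: "|T i| \<le>o |A|" for i
  proof -
    have "|T i| \<le>o |A2|"
      unfolding T_def
    proof (rule Suc.IH)
      fix \<alpha> :: "(nat \<Rightarrow> 'm) \<Rightarrow> 'm list" assume \<alpha>: "simple_tuple (n + n) \<alpha>"
      have "\<alpha> e \<in> A2 \<longleftrightarrow> take n (\<alpha> e) \<in> A \<and> drop n (\<alpha> e) \<in> A" for e
        using length_simple_tuple[OF \<alpha>] by (simp add: A2_def tuples_def)
      then show "definable_pred (\<lambda>e. \<alpha> e \<in> A2)"
        using \<alpha> by (simp add: definable_pred_conj A(1) simple_tuple_take simple_tuple_drop)
      fix \<beta> :: "(nat \<Rightarrow> 'm) \<Rightarrow> 'm list" assume \<beta>: "simple_tuple m \<beta>"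
      have fin: "finite (G p (drop n (\<alpha> e)) (\<beta> e))" for p e
        by (intro finite_G)
           (simp_all add: tuples_def length_simple_tuple[OF \<alpha>] length_simple_tuple[OF \<beta>])
      have "definable_family (\<lambda>e. sel i (drop n (\<alpha> e)) (\<beta> e))"
        unfolding sel_def
        by (cases i) (simp add: definable_family_cell G fin \<alpha> \<beta> simple_tuple_drop)
      then have "definable_pred (\<lambda>e. e 0 \<in> sel i (drop n (\<alpha> (\<lambda>k. e (Suc k)))) (\<beta> (\<lambda>k. e (Suc k))))"
        unfolding definable_family_def .
      moreover have "definable_pred (\<lambda>e. \<phi> (take n (\<alpha> (\<lambda>k. e (Suc k)))) (e 0 # \<beta> (\<lambda>k. e (Suc k))))"
        by (rule \<phi>[OF simple_tuple_shift[OF simple_tuple_take[OF \<alpha>]]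
              simple_tuple_Cons[OF simple_term_var simple_tuple_shift[OF \<beta>]]])
      ultimately have "definable_pred (\<lambda>e. e 0 \<in> sel i (drop n (\<alpha> (\<lambda>k. e (Suc k)))) (\<beta> (\<lambda>k. e (Suc k))) \<and>
          \<phi> (take n (\<alpha> (\<lambda>k. e (Suc k)))) (e 0 # \<beta> (\<lambda>k. e (Suc k))))"
        by (rule definable_pred_conj)
      then show "definable_pred (\<lambda>e. \<psi> i (\<alpha> e) (\<beta> e))"
        unfolding \<psi>_def by (rule definable_pred_ex)
    next
      show "A2 \<subseteq> tuples (n + n)"
        by (auto simp: A2_def)
      \<comment> \<open>Fixing the second half embeds \<open>A\<close> into
        \<open>A2\<close>.\<close>
      obtain a where "a \<in> A" using A(3) by fastforce
      then have "(\<lambda>x. x @ a) ` A \<subseteq> A2"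
        using A2_append by blast
      then show "infinite A2"
        using A(3) by (metis finite_imageD finite_subset inj_onI append_same_eq)
    qed
    also have "|A2| \<le>o |A \<times> A|"
    proof (rule card_of_ordLeqI[of "\<lambda>l. (take n l, drop n l)"])
      show "inj_on (\<lambda>l. (take n l, drop n l)) A2"
        by (rule inj_onI) (metis append_take_drop_id prod.inject)
    qed (auto simp: A2_def)
    also have "|A \<times> A| =o |A|"
      using A(3) by (rule card_of_Times_same_infinite)
    finally show ?thesis .
  qed

  \<comment> \<open>Each trace is recovered from an index \<open>i\<close>, a point \<open>a\<close>
    and a member of \<open>T i\<close>, by fixing the second half of the concatenation to be
    \<open>a\<close>.\<close>
  have "(\<lambda>b. {a \<in> A. \<phi> a b}) ` tuples (Suc m) \<subseteq> (\<Union>i. \<Union>a\<in>A. (\<lambda>W. {x \<in> A. x @ a \<in> W}) ` T i)"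
  proof
    fix X assume "X \<in> (\<lambda>b. {a \<in> A. \<phi> a b}) ` tuples (Suc m)"
    then obtain t b where b: "b \<in> tuples m" and X: "X = {a \<in> A. \<phi> a (t # b)}"
      by (auto simp: tuples_def length_Suc_conv)
    obtain i a where a: "a \<in> A" "t \<in> sel i a b"
      and uniq: "\<And>t' x. t' \<in> sel i a b \<Longrightarrow> x \<in> A \<Longrightarrow> \<phi> x (t' # b) \<longleftrightarrow> \<phi> x (t # b)"
      using sel[OF b] by blast
    have \<psi>_iff: "\<psi> i (x @ a) b \<longleftrightarrow> \<phi> x (t # b)" if "x \<in> A" for x
    proof -
      have "length x = n" using that A(2) by (auto simp: tuples_def)
      then have "take n (x @ a) = x" "drop n (x @ a) = a" by simp_all
      then show ?thesis
        unfolding \<psi>_def by (metis a(2) uniq[OF _ that])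
    qed
    have "X = {x \<in> A. x @ a \<in> {l \<in> A2. \<psi> i l b}}"
      unfolding X mem_Collect_eq using \<psi>_iff A2_append[OF _ a(1)] by (intro Collect_cong) blast
    moreover have "{l \<in> A2. \<psi> i l b} \<in> T i"
      unfolding T_def using b by (rule imageI)
    ultimately have "X \<in> (\<lambda>W. {x \<in> A. x @ a \<in> W}) ` T i"
      by (rule image_eqI)
    then show "X \<in> (\<Union>i. \<Union>a\<in>A. (\<lambda>W. {x \<in> A. x @ a \<in> W}) ` T i)"
      by (intro UN_I[OF UNIV_I] UN_I[OF a(1)])
  qed
  then have "|(\<lambda>b. {a \<in> A. \<phi> a b}) ` tuples (Suc m)| \<le>o
      |\<Union>i. \<Union>a\<in>A. (\<lambda>W. {x \<in> A. x @ a \<in> W}) ` T i|"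
    by (rule card_of_mono1)
  \<comment> \<open>There are countably many indices, \<open>|A|\<close> points and at most
    \<open>|A|\<close> members of each \<open>T i\<close>; as \<open>A\<close> is infinite, the
    union is no larger than \<open>A\<close>.\<close>
  also have "|\<Union>i. \<Union>a\<in>A. (\<lambda>W. {x \<in> A. x @ a \<in> W}) ` T i| \<le>o |A|"
  proof (rule card_of_UNION_ordLeq_infinite[OF A(3)])
    have "|UNIV :: (bool \<times> bool \<times> nat) set| \<le>o |UNIV :: nat set|"
      by (rule card_of_ordLeqI[of to_nat]) auto
    also have "|UNIV :: nat set| \<le>o |A|"
      using A(3) by (simp add: infinite_iff_card_of_nat)
    finally show "|UNIV :: (bool \<times> bool \<times> nat) set| \<le>o |A|" .
    show "\<forall>i\<in>UNIV. |\<Union>a\<in>A. (\<lambda>W. {x \<in> A. x @ a \<in> W}) ` T i| \<le>o |A|"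
    proof
      fix i
      show "|\<Union>a\<in>A. (\<lambda>W. {x \<in> A. x @ a \<in> W}) ` T i| \<le>o |A|"
        by (rule card_of_UNION_ordLeq_infinite[OF A(3)])
           (rule card_of_mono1[OF subset_refl], rule ballI, rule ordLeq_transitive[OF card_of_image T])
    qed
  qed
  finally show ?case .
qed

end

theorem proposition1:
  fixes L :: "('f, 'r) language"
    and M :: "('f, 'r, 'm::unbounded_dense_linorder) fo_structure"
    and \<phi> :: "('f, 'r) formula"
    and x y :: "nat list"
    and A :: "'m list set"
  assumes "o_minimal L M"
    and "partitioned_formula L \<phi> x y"
    and "definable L M (length x) A"
    and "infinite A"
  shows "|(\<lambda>b. formula_trace M \<phi> x y A b) ` tuples (length y)| \<le>o |A|"
proof -
  interpret o_minimal_structure L M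
    by unfold_locales (rule assms(1))
  show ?thesis
    unfolding formula_trace_def
  proof (rule traces_le)
    show "A \<subseteq> tuples (length x)"
      using assms(3) unfolding definable_def by blast
  qed (use assms in \<open>auto simp: partitioned_formula_def
      intro: definable_pred_mem definable_pred_holds_at\<close>)
qed

end
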